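(* Let $d:\mathbb{R}^3\to\mathbb{S}^2$, $d\in L^\infty(\mathbb{R}^3)$, be a smooth solution of the harmonic map equation $$-\Delta d=|\nabla d|^2 d\quad\text{in }\mathbb{R}^3.$$ Assume that $$\lim_{|x|\to\infty}|\nabla d(x)|=0$$ and that $d$ is rotationally symmetric, meaning that $d=d(r)$ depends only on $r=\sqrt{x_1^2+x_2^2+x_3^2}$. Then $d$ is a constant vector in $\mathbb{S}^2$.
   Context: $\mathbb{S}^2\subset\mathbb{R}^3$ is the unit sphere, so $|d|=1$, and $|\nabla d|^2=\sum_{i,k=1}^3\left|\frac{\partial d_k}{\partial x_i}\right|^2$. *)

theory Defs
  imports "HOL-Analysis.Analysis"
begin

definition partial_deriv :: "'n \<Rightarrow> (real ^ 'n \<Rightarrow> 'b::real_normed_vector) \<Rightarrow> real ^ 'n \<Rightarrow> 'b" where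
  "partial_deriv i f x = vector_derivative (\<lambda>t. f (x + t *\<^sub>R axis i 1)) (at 0)"

text \<open>\<^term>\<open>partial_deriv\<close> is total, so differentiability has to be demanded separately at each
  order. With it, this is the usual class of k times continuously differentiable functions.\<close>

primrec continuously_differentiable ::
    "nat \<Rightarrow> (real ^ 'n \<Rightarrow> 'b::real_normed_vector) \<Rightarrow> bool" where
  "continuously_differentiable 0 f \<longleftrightarrow> continuous_on UNIV f"
| "continuously_differentiable (Suc k) f \<longleftrightarrow>
     (\<forall>x. f differentiable (at x)) \<and> (\<forall>i. continuously_differentiable k (partial_deriv i f))"

definition smooth :: "(real ^ 'n \<Rightarrow> 'b::real_normed_vector) \<Rightarrow> bool" where
  "smooth f \<longleftrightarrow> (\<forall>k. continuously_differentiable k f)"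

definition laplacian :: "(real ^ 'n \<Rightarrow> 'b::real_normed_vector) \<Rightarrow> real ^ 'n \<Rightarrow> 'b" where
  "laplacian f x = (\<Sum>i\<in>UNIV. partial_deriv i (partial_deriv i f) x)"

definition grad_norm :: "(real ^ 'n \<Rightarrow> real ^ 'm) \<Rightarrow> real ^ 'n \<Rightarrow> real" where
  "grad_norm f x = sqrt (\<Sum>i\<in>UNIV. \<Sum>k\<in>UNIV. \<bar>partial_deriv i (\<lambda>y. f y $ k) x\<bar>\<^sup>2)"

definition L_infinity :: "(real ^ 'n \<Rightarrow> real ^ 'm) \<Rightarrow> bool" where
  "L_infinity f \<longleftrightarrow>
     f \<in> borel_measurable lebesgue \<and> (\<exists>C. AE x in lebesgue. norm (f x) \<le> C)"

definition rotationally_symmetric :: "(real ^ 'n \<Rightarrow> 'b) \<Rightarrow> bool" where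
  "rotationally_symmetric f \<longleftrightarrow> (\<exists>g :: real \<Rightarrow> 'b. \<forall>x. f x = g (norm x))"

definition harmonic_map_equation :: "(real ^ 'n \<Rightarrow> real ^ 'm) \<Rightarrow> bool" where
  "harmonic_map_equation f \<longleftrightarrow> (\<forall>x. - laplacian f x = (grad_norm f x)\<^sup>2 *\<^sub>R f x)"

end

theory Submission
  imports Defs
begin

text \<open>
  A radial map is determined by its profile along one coordinate axis,
  \<open>h t = d (t e\<^sub>k)\<close>, and for the profile the harmonic map equation in dimension \<open>n\<close> becomes
  \<open>h'' + (n - 1) / t h' = - \<bar>h'\<bar>\<^sup>2 h\<close> for \<open>t > 0\<close>
  (\<open>laplacian_radial\<close>, \<open>grad_norm_radial\<close>). The right-hand side is normal to the sphere,
  while \<open>h'\<close> is tangent to it because \<open>\<bar>h\<bar> = 1\<close>. Pairing the equation with \<open>h'\<close> therefore kills the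
  nonlinearity and leaves \<open>(\<bar>h'\<bar>\<^sup>2)' + 2 (n - 1) / t \<bar>h'\<bar>\<^sup>2 = 0\<close>; that is,
  \<open>t\<^bsup>2 (n - 1)\<^esup> \<bar>h'\<bar>\<^sup>2\<close> is conserved. Smoothness at the origin forces this constant to vanish, since
  the even function \<open>h\<close> has \<open>h' 0 = 0\<close>. Hence \<open>h' = 0\<close> and \<open>d\<close> is constant
  (\<open>radial_sphere_ode_deriv_zero\<close>, \<open>radial_harmonic_map_constant\<close>).

  The regularity at the origin is essential: on the punctured space there are nonconstant radial
  solutions, which run along a great circle with \<open>\<bar>h'\<bar>\<close> proportional to
  \<open>t\<^bsup>1 - n\<^esup>\<close>.
\<close>

section \<open>Partial derivatives\<close>

lemma has_vector_derivative_axis_line: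
  assumes "(f has_derivative D) (at (x + t *\<^sub>R axis i 1))"
  shows "((\<lambda>s. f (x + s *\<^sub>R axis i 1)) has_vector_derivative D (axis i 1)) (at t)"
proof -
  have "((\<lambda>s. x + s *\<^sub>R axis i 1) has_derivative (\<lambda>s. s *\<^sub>R axis i 1)) (at t)"
    by (auto intro!: derivative_eq_intros)
  then have "((\<lambda>s. f (x + s *\<^sub>R axis i 1)) has_derivative (\<lambda>s. D (s *\<^sub>R axis i 1))) (at t)"
    using has_derivative_compose[of _ _ t UNIV f D] assms by simp
  then show ?thesis
    using assms by (simp add: has_vector_derivative_def has_derivative_linear linear_cmul)
qed

lemma partial_deriv_eq_derivative:
  assumes "(f has_derivative D) (at x)"
  shows "partial_deriv i f x = D (axis i 1)"
  unfolding partial_deriv_def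
  using has_vector_derivative_axis_line[of f D x 0 i] assms by (simp add: vector_derivative_at)

lemma has_vector_derivative_along_axis:
  assumes "f differentiable (at (x + t *\<^sub>R axis i 1))"
  shows "((\<lambda>s. f (x + s *\<^sub>R axis i 1)) has_vector_derivative
           partial_deriv i f (x + t *\<^sub>R axis i 1)) (at t)"
  using assms has_vector_derivative_axis_line partial_deriv_eq_derivative
  unfolding differentiable_def by metis

lemma partial_deriv_component:
  fixes f :: "real ^ 'n \<Rightarrow> real ^ 'm"
  assumes "f differentiable (at x)"
  shows "partial_deriv i (\<lambda>y. f y $ k) x = partial_deriv i f x $ k"
proof -
  obtain D where D: "(f has_derivative D) (at x)"
    using assms by (auto simp: differentiable_def)
  then have "((\<lambda>y. f y $ k) has_derivative (\<lambda>y. D y $ k)) (at x)"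
    by (rule bounded_linear.has_derivative[OF bounded_linear_vec_nth])
  then show ?thesis
    by (simp add: partial_deriv_eq_derivative[OF D] partial_deriv_eq_derivative)
qed

lemma grad_norm_squared:
  fixes f :: "real ^ 'n \<Rightarrow> real ^ 'm"
  assumes "f differentiable (at x)"
  shows "(grad_norm f x)\<^sup>2 = (\<Sum>i\<in>UNIV. (norm (partial_deriv i f x))\<^sup>2)"
proof -
  have "(grad_norm f x)\<^sup>2 = (\<Sum>i\<in>UNIV. \<Sum>k\<in>UNIV. \<bar>partial_deriv i (\<lambda>y. f y $ k) x\<bar>\<^sup>2)"
    unfolding grad_norm_def by (intro real_sqrt_pow2 sum_nonneg) auto
  also have "\<dots> = (\<Sum>i\<in>UNIV. (norm (partial_deriv i f x))\<^sup>2)"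
    by (simp add: partial_deriv_component[OF assms] norm_vec_def L2_set_def sum_nonneg)
  finally show ?thesis .
qed

section \<open>Radial functions on a coordinate axis\<close>

lemma rotationally_symmetric_iff_norm:
  fixes f :: "real ^ 'n \<Rightarrow> 'b"
  shows "rotationally_symmetric f \<longleftrightarrow> (\<forall>x y. norm x = norm y \<longrightarrow> f x = f y)"
proof
  assume R: "\<forall>x y. norm x = norm y \<longrightarrow> f x = f y"
  have "f x = f (SOME y. norm y = norm x)" for x
  proof -
    have "norm (SOME y :: real ^ 'n. norm y = norm x) = norm x"
      by (rule someI[of _ x]) (rule refl)
    then show ?thesis
      using R by metis
  qed
  then show "rotationally_symmetric f"
    unfolding rotationally_symmetric_def
    by (intro exI[of _ "\<lambda>r. f (SOME y. norm y = r)"] allI)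
next
  assume "rotationally_symmetric f"
  then show "\<forall>x y. norm x = norm y \<longrightarrow> f x = f y"
    unfolding rotationally_symmetric_def by metis
qed

text \<open>In a direction orthogonal to the position vector a radial function is even, so it is
  stationary there; this applies to every direction at the origin.\<close>

lemma partial_deriv_radial_orthogonal:
  assumes diff: "f differentiable (at x)"
    and rad: "rotationally_symmetric f"
    and orth: "x $ i = 0"
  shows "partial_deriv i f x = 0"
proof -
  let ?p = "\<lambda>s. f (x + s *\<^sub>R axis i 1)"
  have "orthogonal x (axis i 1)"
    using orth by (simp add: orthogonal_def inner_axis)
  then have "norm (x + (- s) *\<^sub>R axis i 1) = norm (x + s *\<^sub>R axis i 1)" for s
    by (simp add: norm_eq inner_simps orthogonal_def inner_commute)
  then have even: "?p (- s) = ?p s" for s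
    using rad unfolding rotationally_symmetric_iff_norm by blast
  have p: "(?p has_vector_derivative partial_deriv i f x) (at 0)"
    using has_vector_derivative_along_axis[of f x 0 i] diff by simp
  have "((?p \<circ> uminus) has_vector_derivative (- 1) *\<^sub>R partial_deriv i f x) (at 0)"
    by (rule vector_diff_chain_at) (use p in \<open>auto intro!: derivative_eq_intros\<close>)
  moreover have "?p \<circ> uminus = ?p"
    using even by (simp add: fun_eq_iff)
  ultimately have "(?p has_vector_derivative - partial_deriv i f x) (at 0)"
    by simp
  then have "partial_deriv i f x = - partial_deriv i f x"
    using p vector_derivative_unique_at by blast
  then have "partial_deriv i f x + partial_deriv i f x = 0"
    by (metis add.right_inverse)
  then have "2 *\<^sub>R partial_deriv i f x = 0"
    by (simp only: scaleR_2)
  then show ?thesis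
    by simp
qed

lemma grad_norm_radial:
  fixes f :: "real ^ 'n \<Rightarrow> real ^ 'm"
  assumes "f differentiable (at (t *\<^sub>R axis k 1))" and "rotationally_symmetric f"
  shows "(grad_norm f (t *\<^sub>R axis k 1))\<^sup>2 = (norm (partial_deriv k f (t *\<^sub>R axis k 1)))\<^sup>2"
proof -
  have "partial_deriv i f (t *\<^sub>R axis k 1) = 0" if "i \<noteq> k" for i
    using partial_deriv_radial_orthogonal[OF assms, of i] that by (simp add: axis_def)
  then have "(\<Sum>i\<in>UNIV. (norm (partial_deriv i f (t *\<^sub>R axis k 1)))\<^sup>2)
      = (\<Sum>i\<in>{k}. (norm (partial_deriv i f (t *\<^sub>R axis k 1)))\<^sup>2)"
    by (intro sum.mono_neutral_right) auto
  then show ?thesis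
    by (simp add: grad_norm_squared[OF assms(1)])
qed

text \<open>Along the line through \<open>t e\<^sub>k\<close> in an orthogonal direction the distance to the origin is
  \<open>sqrt (t\<^sup>2 + s\<^sup>2)\<close>, whose first derivative at \<open>s = 0\<close> vanishes and whose second
  is \<open>1 / t\<close>. Only the term with the second derivative of the distance survives.\<close>

lemma second_partial_deriv_radial_orthogonal:
  fixes f :: "real ^ 'n \<Rightarrow> 'b::real_normed_vector"
  assumes diff: "\<And>x. f differentiable (at x)"
    and diff2: "\<And>x. partial_deriv k f differentiable (at x)"
    and rad: "rotationally_symmetric f"
    and "t > 0" and "i \<noteq> k"
  shows "partial_deriv i (partial_deriv i f) (t *\<^sub>R axis k 1)
    = (1 / t) *\<^sub>R partial_deriv k f (t *\<^sub>R axis k 1)"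
proof -
  define h where "h = (\<lambda>s. f (s *\<^sub>R axis k 1))"
  define h' where "h' = (\<lambda>s. partial_deriv k f (s *\<^sub>R axis k 1))"
  define r where "r = (\<lambda>s. sqrt (t\<^sup>2 + s\<^sup>2))"
  define x where "x = (\<lambda>s. t *\<^sub>R axis k 1 + s *\<^sub>R axis i 1 :: real ^ 'n)"
  have pos: "t\<^sup>2 + s\<^sup>2 > 0" for s
    using \<open>t > 0\<close> by (simp add: add_pos_nonneg)
  have r_deriv: "(r has_real_derivative s / r s) (at s)" for s
    unfolding r_def using pos[of s] by (auto intro!: derivative_eq_intros simp: field_simps)
  have r0: "r 0 = t"
    using \<open>t > 0\<close> by (simp add: r_def)
  have h: "(h has_vector_derivative h' s) (at s)" for s
    using has_vector_derivative_along_axis[of f 0 s k] diff by (simp add: h_def h'_def)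
  have "(h' has_vector_derivative partial_deriv k (partial_deriv k f) (s *\<^sub>R axis k 1)) (at s)" for s
    using has_vector_derivative_along_axis[of "partial_deriv k f" 0 s k] diff2 by (simp add: h'_def)
  then have h'_diff: "\<exists>D. (h' has_vector_derivative D) (at s)" for s
    by blast
  have "norm (x s) = r s" for s
    using \<open>i \<noteq> k\<close> by (simp add: x_def r_def norm_eq_sqrt_inner inner_simps inner_axis_axis power2_eq_square)
  moreover have "norm (r s *\<^sub>R axis k 1 :: real ^ 'n) = r s" for s
    by (simp add: r_def)
  ultimately have f_x: "f (x s) = (h \<circ> r) s" for s
    using rad unfolding rotationally_symmetric_iff_norm h_def by simp
  have first: "partial_deriv i f (x s) = (s / r s) *\<^sub>R h' (r s)" for s
  proof -
    have "((\<lambda>s. f (x s)) has_vector_derivative partial_deriv i f (x s)) (at s)"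
      unfolding x_def by (rule has_vector_derivative_along_axis) (rule diff)
    moreover have "((h \<circ> r) has_vector_derivative (s / r s) *\<^sub>R h' (r s)) (at s)"
      using r_deriv h by (intro vector_diff_chain_at) (auto simp: has_real_derivative_iff_has_vector_derivative)
    ultimately show ?thesis
      unfolding f_x[abs_def] comp_def using vector_derivative_unique_at by blast
  qed
  obtain D where "(h' has_vector_derivative D) (at (r 0))"
    using h'_diff by blast
  then have hr: "((\<lambda>s. h' (r s)) has_vector_derivative (0 / r 0) *\<^sub>R D) (at 0)"
    using vector_diff_chain_at[of r "0 / r 0" 0 h' D] r_deriv[of 0]
    by (simp add: has_real_derivative_iff_has_vector_derivative comp_def)
  have "((\<lambda>s. s / r s) has_real_derivative 1 / t) (at 0)"
    using r_deriv[of 0] r0 \<open>t > 0\<close>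
    by (auto intro!: derivative_eq_intros simp: field_simps)
  then have "((\<lambda>s. (s / r s) *\<^sub>R h' (r s)) has_vector_derivative (1 / t) *\<^sub>R h' t) (at 0)"
    using has_vector_derivative_scaleR[OF _ hr, of "\<lambda>s. s / r s" "1 / t"] r0 by simp
  then have "((\<lambda>s. partial_deriv i f (x s)) has_vector_derivative (1 / t) *\<^sub>R h' t) (at 0)"
    by (simp only: first)
  then show ?thesis
    unfolding partial_deriv_def[of i "partial_deriv i f"] x_def h'_def
    by (rule vector_derivative_at)
qed

lemma laplacian_radial:
  fixes f :: "real ^ 'n \<Rightarrow> 'b::real_normed_vector"
  assumes "\<And>x. f differentiable (at x)"
    and "\<And>x. partial_deriv k f differentiable (at x)"
    and "rotationally_symmetric f"
    and "t > 0"
  shows "laplacian f (t *\<^sub>R axis k 1)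
    = partial_deriv k (partial_deriv k f) (t *\<^sub>R axis k 1)
      + (real (CARD('n) - 1) / t) *\<^sub>R partial_deriv k f (t *\<^sub>R axis k 1)"
proof -
  have "(\<Sum>i\<in>UNIV - {k}. partial_deriv i (partial_deriv i f) (t *\<^sub>R axis k 1))
      = (\<Sum>i\<in>UNIV - {k}. (1 / t) *\<^sub>R partial_deriv k f (t *\<^sub>R axis k 1))"
    by (rule sum.cong) (auto intro!: second_partial_deriv_radial_orthogonal assms)
  then show ?thesis
    by (simp add: laplacian_def sum.remove[of UNIV k] card_Diff_singleton sum_constant_scaleR)
qed

section \<open>The profile equation\<close>

text \<open>The conserved quantity is \<open>t\<^bsup>2 m\<^esup> \<bar>h' t\<bar>\<^sup>2\<close>, and the initial condition
  makes it zero. For \<open>m = 0\<close> the power is \<open>1\<close> at the origin as well, and it is the value of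
  \<open>h'\<close> there that excludes great circles traversed at constant speed.\<close>

lemma radial_sphere_ode_deriv_zero:
  fixes h h' h'' :: "real \<Rightarrow> 'b::real_inner"
  assumes h: "\<And>t. (h has_vector_derivative h' t) (at t)"
    and h': "\<And>t. (h' has_vector_derivative h'' t) (at t)"
    and unit: "\<And>t. norm (h t) = 1"
    and ode: "\<And>t. t > 0 \<Longrightarrow> h'' t + (real m / t) *\<^sub>R h' t = c t *\<^sub>R h t"
    and init: "h' 0 = 0"
    and "t > 0"
  shows "h' t = 0"
proof -
  have tangent: "h s \<bullet> h' s = 0" for s
  proof -
    have "((\<lambda>s. h s \<bullet> h s) has_vector_derivative (h s \<bullet> h' s + h' s \<bullet> h s)) (at s)"
      by (rule bounded_bilinear.has_vector_derivative[OF bounded_bilinear_inner h h])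
    moreover have "(\<lambda>s. h s \<bullet> h s) = (\<lambda>s. 1)"
      using unit by (simp add: dot_square_norm)
    ultimately have "((\<lambda>s. 1::real) has_vector_derivative (h s \<bullet> h' s + h' s \<bullet> h s)) (at s)"
      by simp
    then have "h s \<bullet> h' s + h' s \<bullet> h s = 0"
      using vector_derivative_unique_at has_vector_derivative_const by blast
    then show ?thesis
      by (simp add: inner_commute)
  qed
  define E where "E = (\<lambda>s. s ^ (2 * m) * (h' s \<bullet> h' s))"
  have E_deriv: "(E has_real_derivative
      s ^ (2 * m) * (2 * (h' s \<bullet> h'' s)) + real (2 * m) * s ^ (2 * m - 1) * (h' s \<bullet> h' s)) (at s)" for s
  proof -
    have "((\<lambda>s. h' s \<bullet> h' s) has_real_derivative 2 * (h' s \<bullet> h'' s)) (at s)"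
      using bounded_bilinear.has_vector_derivative[OF bounded_bilinear_inner h' h']
      by (simp add: has_real_derivative_iff_has_vector_derivative inner_commute)
    then show ?thesis
      unfolding E_def by (auto intro!: derivative_eq_intros)
  qed
  have E_const: "(E has_real_derivative 0) (at s)" if "s > 0" for s
  proof -
    have "h' s \<bullet> (h'' s + (real m / s) *\<^sub>R h' s) = 0"
      using ode[OF that] tangent[of s] by (simp add: inner_commute)
    then have dissipation: "h' s \<bullet> h'' s = - (real m / s) * (h' s \<bullet> h' s)"
      by (simp add: inner_simps)
    have "s ^ (2 * m) * (2 * (h' s \<bullet> h'' s)) + real (2 * m) * s ^ (2 * m - 1) * (h' s \<bullet> h' s) = 0"
    proof (cases m)
      case 0
      then show ?thesis by (simp add: dissipation)
    next
      case (Suc l)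
      then show ?thesis using that by (simp add: dissipation field_simps)
    qed
    then show ?thesis
      using E_deriv[of s] by simp
  qed
  have "continuous_on {0..t} E"
    using E_deriv by (meson DERIV_isCont continuous_at_imp_continuous_on)
  then have "E t = E 0"
    using DERIV_isconst_end[of 0 t E] E_const \<open>t > 0\<close> by blast
  then show ?thesis
    using init \<open>t > 0\<close> by (simp add: E_def)
qed

section \<open>Rotationally symmetric harmonic maps\<close>

theorem radial_harmonic_map_constant:
  fixes f :: "real ^ 'n \<Rightarrow> real ^ 'm"
  assumes unit: "\<And>x. norm (f x) = 1"
    and diff: "\<And>x. f differentiable (at x)"
    and diff2: "\<And>i x. partial_deriv i f differentiable (at x)"
    and eq: "harmonic_map_equation f"
    and rad: "rotationally_symmetric f"
  shows "f x = f 0"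
proof -
  obtain k :: 'n where True by simp
  define h where "h = (\<lambda>s. f (s *\<^sub>R axis k 1))"
  define h' where "h' = (\<lambda>s. partial_deriv k f (s *\<^sub>R axis k 1))"
  define h'' where "h'' = (\<lambda>s. partial_deriv k (partial_deriv k f) (s *\<^sub>R axis k 1))"
  have h: "(h has_vector_derivative h' s) (at s)" for s
    using has_vector_derivative_along_axis[of f 0 s k] diff by (simp add: h_def h'_def)
  have h': "(h' has_vector_derivative h'' s) (at s)" for s
    using has_vector_derivative_along_axis[of "partial_deriv k f" 0 s k] diff2
    by (simp add: h'_def h''_def)
  have ode: "h'' s + (real (CARD('n) - 1) / s) *\<^sub>R h' s = - (norm (h' s))\<^sup>2 *\<^sub>R h s"
    if "s > 0" for s
  proof -
    have "- laplacian f (s *\<^sub>R axis k 1) = (norm (h' s))\<^sup>2 *\<^sub>R h s"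
      using eq by (simp add: harmonic_map_equation_def grad_norm_radial diff rad h_def h'_def)
    then have "laplacian f (s *\<^sub>R axis k 1) = - ((norm (h' s))\<^sup>2 *\<^sub>R h s)"
      by (metis minus_minus)
    then show ?thesis
      using laplacian_radial[OF diff diff2 rad that, of k] by (simp add: h'_def h''_def)
  qed
  have "h' 0 = 0"
    using partial_deriv_radial_orthogonal[of f 0 k] diff rad by (simp add: h'_def)
  then have h'_zero: "h' s = 0" if "s \<ge> 0" for s
    using radial_sphere_ode_deriv_zero[OF h h' _ ode, of s] that unit
    by (cases "s = 0") (auto simp: h_def)
  have "h (norm x) = h 0"
  proof -
    have "(h has_vector_derivative 0) (at s within {0..})" if "s \<in> {0..}" for s
      using h[of s] h'_zero[of s] that by (simp add: has_vector_derivative_at_within)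
    then obtain c where "h s = c" if "s \<in> {0..}" for s
      using has_vector_derivative_zero_constant[of "{0..}" h] by (metis convex_real_interval(1))
    then show ?thesis by simp
  qed
  moreover have "norm x = norm (norm x *\<^sub>R axis k 1 :: real ^ 'n)"
    by simp
  then have "f x = h (norm x)"
    using rad unfolding rotationally_symmetric_iff_norm h_def by blast
  ultimately show ?thesis
    by (simp add: h_def)
qed

theorem theorem1p4:
  fixes d :: "real ^ 3 \<Rightarrow> real ^ 3"
  assumes "\<And>x. d x \<in> sphere 0 1"
    and "L_infinity d"
    and "smooth d"
    and "harmonic_map_equation d"
    and "(grad_norm d \<longlongrightarrow> 0) at_infinity"
    and "rotationally_symmetric d"
  shows "\<exists>c\<in>sphere 0 1. \<forall>x. d x = c"
proof -
  have "continuously_differentiable (Suc (Suc 0)) d"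
    using assms(3) unfolding smooth_def by blast
  then have "d differentiable (at x)" "partial_deriv i d differentiable (at x)" for i x
    by auto
  moreover have "norm (d x) = 1" for x
    using assms(1)[of x] by simp
  ultimately have "d x = d 0" for x
    using radial_harmonic_map_constant[of d x] assms(4,6) by blast
  then show ?thesis
    using assms(1)[of 0] by blast
qed

end
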